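(* Each $f\in\mathrm{Diffeo}(\mathbb{R})$ can be expressed as a composite $f=\tau_1\tau_2\tau_3\tau_4$ of four involutions $\tau_1,\tau_2,\tau_3,\tau_4$ in $\mathrm{Diffeo}(\mathbb{R})$.
   Context: A diffeomorphism of $\mathbb{R}$ is an infinitely differentiable homeomorphism of $\mathbb{R}$ onto itself whose derivative never vanishes. $\mathrm{Diffeo}(\mathbb{R})$ is the group of all diffeomorphisms of $\mathbb{R}$ under composition. An involution in a group is an element $\tau$ with $\tau^2$ equal to the identity (the identity itself is allowed as a trivial involution). *)

theory Defs
  imports "HOL-Analysis.Analysis" "HOL-Algebra.Group"
begin

definition smooth :: "(real \<Rightarrow> real) \<Rightarrow> bool" where
  "smooth f \<longleftrightarrow> (\<forall>n. (deriv ^^ n) f differentiable_on UNIV)"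

definition diffeomorphism :: "(real \<Rightarrow> real) \<Rightarrow> bool" where
  "diffeomorphism f \<longleftrightarrow>
     smooth f \<and> (\<exists>g. homeomorphism UNIV UNIV f g) \<and> (\<forall>x. deriv f x \<noteq> 0)"

definition Diffeo :: "(real \<Rightarrow> real) monoid" where
  "Diffeo = \<lparr>carrier = {f. diffeomorphism f}, mult = (\<circ>), one = id\<rparr>"

text \<open>The identity itself counts as a (trivial) involution.\<close>

definition involution :: "('a, 'b) monoid_scheme \<Rightarrow> 'a \<Rightarrow> bool" where
  "involution G \<tau> \<longleftrightarrow> \<tau> \<in> carrier G \<and> \<tau> [^]\<^bsub>G\<^esub> (2::nat) = \<one>\<^bsub>G\<^esub>"


text \<open>The remainder shows that \<^const>\<open>Diffeo\<close> is indeed a group.\<close>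

definition Ck :: "nat \<Rightarrow> (real \<Rightarrow> real) \<Rightarrow> bool" where
  "Ck n f \<longleftrightarrow> (\<forall>k\<le>n. (deriv ^^ k) f differentiable_on UNIV)"

lemma smooth_iff_Ck: "smooth f \<longleftrightarrow> (\<forall>n. Ck n f)"
  by (auto simp: smooth_def Ck_def)

lemma Ck_0: "Ck 0 f \<longleftrightarrow> f differentiable_on UNIV"
  by (simp add: Ck_def)

lemma Ck_Suc: "Ck (Suc n) f \<longleftrightarrow> f differentiable_on UNIV \<and> Ck n (deriv f)"
proof -
  have *: "(\<forall>k\<le>Suc n. P k) \<longleftrightarrow> P 0 \<and> (\<forall>k\<le>n. P (Suc k))" for P
    by (metis Suc_le_mono not0_implies_Suc zero_le)
  show ?thesis
    unfolding Ck_def * by (simp add: funpow_swap1)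
qed

lemma Ck_mono: "Ck (Suc n) f \<Longrightarrow> Ck n f"
  by (simp add: Ck_def)

lemma Ck_imp_differentiable: "Ck n f \<Longrightarrow> f differentiable_on UNIV"
  by (cases n) (simp_all add: Ck_0 Ck_Suc)

lemma has_deriv: "f differentiable_on UNIV \<Longrightarrow> (f has_real_derivative deriv f x) (at x)"
  by (metis DERIV_imp_deriv UNIV_I differentiable_on_def real_differentiable_def)

lemma Ck_SucI:
  assumes "\<And>x. (f has_real_derivative f' x) (at x)" "Ck n f'"
  shows "Ck (Suc n) f"
proof -
  have "deriv f = f'"
    using assms(1) DERIV_imp_deriv by blast
  moreover have "f differentiable_on UNIV"
    using assms(1) by (auto simp: differentiable_on_def real_differentiable_def)
  ultimately show ?thesis
    using assms(2) by (simp add: Ck_Suc)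
qed

lemma Ck_const: "Ck n (\<lambda>x. c)"
  by (induction n arbitrary: c) (auto simp: Ck_0 intro!: Ck_SucI derivative_eq_intros)

lemma Ck_id: "Ck n id"
proof (cases n)
  case (Suc m)
  have "Ck (Suc m) id"
    by (rule Ck_SucI[OF _ Ck_const[of _ 1]]) (auto simp: id_def)
  then show ?thesis using Suc by simp
qed (simp add: Ck_0 id_def)

lemma Ck_add: "Ck n f \<Longrightarrow> Ck n g \<Longrightarrow> Ck n (\<lambda>x. f x + g x)"
proof (induction n arbitrary: f g)
  case (Suc n)
  then show ?case
    by (intro Ck_SucI[where f' = "\<lambda>x. deriv f x + deriv g x"] DERIV_add has_deriv)
       (auto simp: Ck_Suc)
qed (simp add: Ck_0)

lemma Ck_mult: "Ck n f \<Longrightarrow> Ck n g \<Longrightarrow> Ck n (\<lambda>x. f x * g x)"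
proof (induction n arbitrary: f g)
  case (Suc n)
  have "Ck n (\<lambda>x. deriv f x * g x + deriv g x * f x)"
    using Suc Ck_mono by (intro Ck_add Suc.IH) (auto simp: Ck_Suc)
  then show ?case
    using Suc.prems by (intro Ck_SucI[OF DERIV_mult[OF has_deriv has_deriv]]) (auto simp: Ck_Suc)
qed (simp add: Ck_0)

lemma Ck_inverse: "Ck n f \<Longrightarrow> (\<And>x. f x \<noteq> 0) \<Longrightarrow> Ck n (\<lambda>x. inverse (f x))"
proof (induction n arbitrary: f)
  case 0
  then show ?case by (auto simp: Ck_0 differentiable_on_def intro!: differentiable_inverse)
next
  case (Suc n)
  have "Ck n (\<lambda>x. inverse (f x))"
    using Suc Ck_mono by blast
  then have "Ck n (\<lambda>x. (- 1) * (inverse (f x) * deriv f x * inverse (f x)))"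
    using Suc.prems by (intro Ck_mult Ck_const) (auto simp: Ck_Suc)
  moreover have "((\<lambda>x. inverse (f x)) has_real_derivative
      (- 1) * (inverse (f x) * deriv f x * inverse (f x))) (at x)" for x
    using DERIV_inverse'[OF has_deriv[OF Ck_imp_differentiable[OF Suc.prems(1)], of x]] Suc.prems(2)
    by simp
  ultimately show ?case
    by (intro Ck_SucI)
qed

lemma Ck_comp: "Ck n f \<Longrightarrow> Ck n g \<Longrightarrow> Ck n (f \<circ> g)"
proof (induction n arbitrary: f g)
  case 0
  then show ?case
    using differentiable_chain_at[of g _ f] by (simp add: Ck_0 differentiable_on_def o_def)
next
  case (Suc n)
  have "Ck n (\<lambda>x. (deriv f \<circ> g) x * deriv g x)"
    using Suc Ck_mono by (intro Ck_mult Suc.IH) (auto simp: Ck_Suc)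
  moreover have "((f \<circ> g) has_real_derivative (deriv f \<circ> g) x * deriv g x) (at x)" for x
    unfolding comp_def[of "deriv f"]
    by (intro DERIV_chain has_deriv Ck_imp_differentiable[OF Suc.prems(1)]
        Ck_imp_differentiable[OF Suc.prems(2)])
  ultimately show ?case
    by (intro Ck_SucI)
qed

lemma diffeomorphism_id: "diffeomorphism id"
  by (auto simp: diffeomorphism_def smooth_iff_Ck Ck_id id_def[symmetric]
      homeomorphism_def intro!: exI[of _ id])

lemma diffeomorphism_comp:
  assumes "diffeomorphism f" "diffeomorphism g"
  shows "diffeomorphism (f \<circ> g)"
proof -
  have sm: "\<And>n. Ck n f" "\<And>n. Ck n g"
    using assms by (auto simp: diffeomorphism_def smooth_iff_Ck)
  have "deriv (f \<circ> g) x = deriv f (g x) * deriv g x" for x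
    by (intro DERIV_imp_deriv DERIV_chain has_deriv) (use sm Ck_imp_differentiable in blast)+
  moreover have "\<exists>h. homeomorphism UNIV UNIV (f \<circ> g) h"
    using assms homeomorphism_compose unfolding diffeomorphism_def by blast
  ultimately show ?thesis
    using assms sm Ck_comp by (auto simp: diffeomorphism_def smooth_iff_Ck)
qed

lemma diffeomorphism_inverse:
  assumes "diffeomorphism f" "homeomorphism UNIV UNIV f g"
  shows "diffeomorphism g"
proof -
  have sm: "\<And>n. Ck n f" and nz: "\<And>x. deriv f x \<noteq> 0"
    using assms by (auto simp: diffeomorphism_def smooth_iff_Ck)
  have inv: "\<And>x. f (g x) = x" and cont: "isCont g x" for x
    using assms(2) by (auto simp: homeomorphism_def continuous_on_eq_continuous_at)
  have der: "(g has_real_derivative inverse ((deriv f \<circ> g) x)) (at x)" for x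
    using DERIV_inverse_function[of f "deriv f (g x)" g x "x - 1" "x + 1"] nz inv cont
      has_deriv[OF Ck_imp_differentiable[OF sm]]
    by simp
  have "Ck n g" for n
  proof (induction n)
    case 0
    then show ?case
      using der by (auto simp: Ck_0 differentiable_on_def real_differentiable_def)
  next
    case (Suc n)
    have "Ck n (deriv f)" using sm[of "Suc n"] by (simp add: Ck_Suc)
    then have "Ck n (\<lambda>x. inverse ((deriv f \<circ> g) x))"
      using Suc nz by (intro Ck_inverse Ck_comp) auto
    then show ?case
      using der by (intro Ck_SucI)
  qed
  moreover have "deriv g x \<noteq> 0" for x
    using DERIV_imp_deriv[OF der] nz by simp
  ultimately show ?thesis
    using homeomorphism_symD[OF assms(2)] by (auto simp: diffeomorphism_def smooth_iff_Ck)
qed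

theorem group_Diffeo: "group Diffeo"
proof (rule groupI)
  fix f assume "f \<in> carrier Diffeo"
  then have f: "diffeomorphism f" by (simp add: Diffeo_def)
  then obtain g where g: "homeomorphism UNIV UNIV f g"
    by (auto simp: diffeomorphism_def)
  then have "g \<circ> f = id" by (auto simp: homeomorphism_def)
  then show "\<exists>h\<in>carrier Diffeo. h \<otimes>\<^bsub>Diffeo\<^esub> f = \<one>\<^bsub>Diffeo\<^esub>"
    using diffeomorphism_inverse[OF f g] by (auto simp: Diffeo_def)
qed (auto simp: Diffeo_def diffeomorphism_id diffeomorphism_comp comp_assoc)

end

(*
  If f reverses orientation, there is an orientation-reversing involution \<tau> with \<tau> > f^{-1} pointwise,
  so that g = \<tau> f satisfies g(x) > x. Such a g is smoothly conjugate to x + 1 through a solution \<phi> of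
  Abel's equation \<phi>(g x) = \<phi>(x) + 1, and x + 1 is the composite of the reflections -x and 1 - x.
  Hence f = \<tau> g is a product of three involutions. If f preserves orientation, then f(-x) reverses
  it, and undoing the reflection costs a fourth involution.
*)
theory Submission
  imports Defs
begin

section \<open>Smooth functions\<close>

lemma smooth_has_deriv: "smooth f \<Longrightarrow> (f has_real_derivative deriv f x) (at x)"
  using Ck_imp_differentiable has_deriv smooth_iff_Ck by blast

lemma smooth_continuous: "smooth f \<Longrightarrow> continuous_on UNIV f"
  by (meson DERIV_continuous_on has_field_derivative_at_within smooth_has_deriv)

lemma smooth_deriv: "smooth f \<Longrightarrow> smooth (deriv f)"
  by (metis Ck_Suc smooth_iff_Ck)

lemma smooth_const: "smooth (\<lambda>x. c)"
  by (simp add: smooth_iff_Ck Ck_const)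

lemma smooth_ident: "smooth (\<lambda>x. x)"
  using Ck_id by (simp add: smooth_iff_Ck id_def)

lemma smooth_add: "smooth f \<Longrightarrow> smooth g \<Longrightarrow> smooth (\<lambda>x. f x + g x)"
  by (simp add: smooth_iff_Ck Ck_add)

lemma smooth_mult: "smooth f \<Longrightarrow> smooth g \<Longrightarrow> smooth (\<lambda>x. f x * g x)"
  by (simp add: smooth_iff_Ck Ck_mult)

lemma smooth_diff: "smooth f \<Longrightarrow> smooth g \<Longrightarrow> smooth (\<lambda>x. f x - g x)"
  using smooth_add[of f "\<lambda>x. (- 1) * g x"] smooth_mult[OF smooth_const[of "- 1"], of g] by simp

lemma smooth_uminus: "smooth f \<Longrightarrow> smooth (\<lambda>x. - f x)"
  using smooth_diff[OF smooth_const[of 0], of f] by simp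

lemma smooth_divide:
  "smooth f \<Longrightarrow> smooth g \<Longrightarrow> (\<And>x. g x \<noteq> 0) \<Longrightarrow> smooth (\<lambda>x. f x / g x)"
  by (simp add: smooth_iff_Ck Ck_mult Ck_inverse divide_inverse)

lemma smooth_compose: "smooth f \<Longrightarrow> smooth g \<Longrightarrow> smooth (\<lambda>x. f (g x))"
  using Ck_comp by (simp add: smooth_iff_Ck comp_def)

lemma smooth_funpow: "smooth f \<Longrightarrow> smooth (f ^^ n)"
proof (induction n)
  case (Suc n)
  then show ?case
    using smooth_compose[of f "f ^^ n"] by (simp add: comp_def)
qed (simp add: smooth_ident id_def)

lemma smooth_sum: "(\<And>i. i \<in> I \<Longrightarrow> smooth (f i)) \<Longrightarrow> smooth (\<lambda>x. \<Sum>i\<in>I. f i x)"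
  by (induction I rule: infinite_finite_induct) (auto intro: smooth_const smooth_add)

lemma smooth_exp: "smooth exp"
proof -
  have "Ck n exp" for n
  proof (induction n)
    case 0
    show ?case
      by (auto simp: Ck_0 differentiable_on_def real_differentiable_def intro: DERIV_exp)
  next
    case (Suc n)
    show ?case by (rule Ck_SucI[OF DERIV_exp Suc])
  qed
  then show ?thesis by (simp add: smooth_iff_Ck)
qed

text \<open>Agreement with \<open>F\<close> near \<open>x\<close> persists near every nearby point,
  so \<open>deriv f\<close> agrees locally with \<open>deriv F\<close> and induction applies. This
  gives smoothness of series that reduce to finite sums near each point.\<close>

lemma Ck_local:
  assumes "\<And>x. \<exists>F. Ck n F \<and> (\<forall>\<^sub>F y in nhds x. f y = F y)"
  shows "Ck n f"
  using assms
proof (induction n arbitrary: f)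
  case 0
  have "\<exists>D. (f has_real_derivative D) (at x)" for x
    using 0[of x] DERIV_cong_ev[OF refl _ refl, of f _ x] has_deriv unfolding Ck_0 by blast
  then show ?case
    by (auto simp: Ck_0 differentiable_on_def real_differentiable_def)
next
  case (Suc n)
  have d: "\<exists>D. (f has_real_derivative D) (at x)" for x
    using Suc.prems[of x] DERIV_cong_ev[OF refl _ refl, of f _ x] has_deriv
    unfolding Ck_Suc by blast
  have "\<exists>F. Ck n F \<and> (\<forall>\<^sub>F y in nhds x. deriv f y = F y)" for x
  proof -
    obtain F where F: "Ck (Suc n) F" "\<forall>\<^sub>F y in nhds x. f y = F y"
      using Suc.prems by blast
    have "\<forall>\<^sub>F y in nhds x. \<forall>\<^sub>F z in nhds y. f z = F z"
      using F(2) by (simp add: eventually_eventually)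
    then have "\<forall>\<^sub>F y in nhds x. deriv f y = deriv F y"
      by eventually_elim (simp add: deriv_cong_ev)
    then show ?thesis using F(1) by (auto simp: Ck_Suc)
  qed
  then have "Ck n (deriv f)" by (rule Suc.IH)
  then show ?case
    using d by (auto simp: Ck_Suc differentiable_on_def real_differentiable_def)
qed

lemma smooth_local:
  assumes "\<And>x. \<exists>F. smooth F \<and> (\<forall>\<^sub>F y in nhds x. f y = F y)"
  shows "smooth f"
  unfolding smooth_iff_Ck using assms Ck_local smooth_iff_Ck by metis

section \<open>A smooth step\<close>

text \<open>\<open>flat 0\<close> is the classical exp(-1/x) extended by zero. The powers of 1/x
  make the linear span of the family closed under differentiation.\<close>

definition flat :: "nat \<Rightarrow> real \<Rightarrow> real" where
  "flat k x = (if x > 0 then inverse x ^ k * exp (- inverse x) else 0)"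

lemma flat_nonneg: "flat k x \<ge> 0"
  by (simp add: flat_def)

lemma flat_pos: "x > 0 \<Longrightarrow> flat k x > 0"
  by (simp add: flat_def)

lemma flat_eq_0: "x \<le> 0 \<Longrightarrow> flat k x = 0"
  by (simp add: flat_def)

text \<open>Substituting y = 1/x, the exponential beats every power.\<close>

lemma flat_tendsto_0: "(flat k \<longlongrightarrow> 0) (at 0)"
proof -
  have "((\<lambda>y::real. y ^ k / exp y) \<longlongrightarrow> 0) at_top"
    by (rule tendsto_power_div_exp_0)
  then have "((\<lambda>x::real. inverse x ^ k / exp (inverse x)) \<longlongrightarrow> 0) (at_right 0)"
    by (rule filterlim_compose[OF _ filterlim_inverse_at_top_right])
  then have "(flat k \<longlongrightarrow> 0) (at_right 0)"
    by (rule Lim_transform_eventually)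
       (auto simp: flat_def exp_minus divide_inverse eventually_at_filter)
  moreover have "(flat k \<longlongrightarrow> 0) (at_left 0)"
    by (rule Lim_transform_eventually[OF tendsto_const])
       (auto simp: flat_def eventually_at_filter)
  ultimately show ?thesis by (rule filterlim_split_at[rotated])
qed

lemma DERIV_flat:
  "(flat k has_real_derivative flat (k + 2) x - of_nat k * flat (k + 1) x) (at x)"
proof (cases x "0::real" rule: linorder_cases)
  case less
  have "(flat k has_real_derivative 0) (at x) \<longleftrightarrow> ((\<lambda>_. 0) has_real_derivative 0) (at x)"
    by (rule DERIV_cong_ev[OF refl _ refl])
       (use less in \<open>auto intro!: eventually_nhds_in_open[of "{..<0}", THEN eventually_mono]
                    simp: flat_def\<close>)
  then show ?thesis using less by (simp add: flat_def)
next
  case equal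
  \<comment> \<open>Away from 0 the difference quotient of \<open>flat k\<close> at 0 is
    \<open>flat (Suc k)\<close>.\<close>
  have "((\<lambda>h. (flat k h - flat k 0) / h) \<longlongrightarrow> 0) (at 0)"
    by (rule Lim_transform_eventually[OF flat_tendsto_0[of "Suc k"]])
       (auto simp: flat_def eventually_at_filter divide_inverse)
  then show ?thesis
    using equal by (simp add: DERIV_def flat_eq_0)
next
  case greater
  let ?g = "\<lambda>x::real. inverse x ^ k * exp (- inverse x)"
  let ?D = "flat (k + 2) x - of_nat k * flat (k + 1) x"
  have "(flat k has_real_derivative ?D) (at x) \<longleftrightarrow> (?g has_real_derivative ?D) (at x)"
    by (rule DERIV_cong_ev[OF refl _ refl])
       (use greater in \<open>auto intro!: eventually_nhds_in_open[of "{0<..}", THEN eventually_mono]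
                    simp: flat_def\<close>)
  moreover have "(?g has_real_derivative ?D) (at x)"
  proof -
    have inv: "(inverse has_real_derivative - (inverse x ^ 2)) (at x)"
      using DERIV_inverse[of x UNIV] greater by (simp add: numeral_2_eq_2)
    have "((\<lambda>x. inverse x ^ k) has_real_derivative - of_nat k * inverse x ^ (k + 1)) (at x)"
      by (rule DERIV_cong[OF DERIV_power[OF inv]])
         (cases k; simp add: power2_eq_square algebra_simps)
    moreover have "((\<lambda>x. exp (- inverse x)) has_real_derivative
        exp (- inverse x) * inverse x ^ 2) (at x)"
      by (rule DERIV_cong[OF DERIV_fun_exp[OF DERIV_minus[OF inv]]]) simp
    ultimately show ?thesis
      by (rule DERIV_cong[OF DERIV_mult])
         (use greater in \<open>simp add: flat_def power2_eq_square algebra_simps\<close>)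
  qed
  ultimately show ?thesis by simp
qed

lemma smooth_flat: "smooth (flat k)"
proof -
  have "Ck n (flat k)" for n k
  proof (induction n arbitrary: k)
    case 0
    show ?case
      using DERIV_flat by (auto simp: Ck_0 differentiable_on_def real_differentiable_def)
  next
    case (Suc n)
    have "Ck n (\<lambda>x. flat (k + 2) x + (- of_nat k) * flat (k + 1) x)"
      by (intro Ck_add Ck_mult Ck_const Suc)
    then show ?case
      using DERIV_flat[of k] by (intro Ck_SucI) auto
  qed
  then show ?thesis by (simp add: smooth_iff_Ck)
qed

text \<open>The step is the quotient of \<open>flat 0 x\<close> by
  \<open>flat 0 x + flat 0 (b - x)\<close>. The denominator is positive because \<open>x\<close> or
  \<open>b - x\<close> is.\<close>

lemma smooth_step:
  fixes b :: real
  assumes "0 < b"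
  obtains \<psi> where "smooth \<psi>" "mono \<psi>" "\<And>x. x \<le> 0 \<Longrightarrow> \<psi> x = 0" "\<And>x. b \<le> x \<Longrightarrow> \<psi> x = 1"
    "\<And>x. 0 < x \<Longrightarrow> x < b \<Longrightarrow> deriv \<psi> x > 0"
proof
  define d where "d x = flat 0 x + flat 0 (b - x)" for x
  define \<psi> where "\<psi> x = flat 0 x / d x" for x
  \<comment> \<open>Quotient rule after the terms \<open>flat 0 x * flat 2 x\<close> cancel; no
    negative term is left, so the sign is visible.\<close>
  define \<psi>' where "\<psi>' x = (flat 2 x * flat 0 (b - x) + flat 0 x * flat 2 (b - x)) / (d x)\<^sup>2" for x
  have pos: "d x > 0" for x
    using assms flat_nonneg[of 0 x] flat_nonneg[of 0 "b - x"] flat_pos[of x 0] flat_pos[of "b - x" 0]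
    unfolding d_def by (cases "x > 0") auto
  have smooth_d: "smooth d"
    unfolding d_def
    by (intro smooth_add smooth_flat smooth_compose[OF smooth_flat] smooth_diff smooth_const
        smooth_ident)
  then show "smooth \<psi>"
    unfolding \<psi>_def using pos by (intro smooth_divide smooth_flat) (auto simp: less_imp_neq[symmetric])
  have D: "(\<psi> has_real_derivative \<psi>' x) (at x)" for x
  proof -
    have d1: "(flat 0 has_real_derivative flat 2 x) (at x)" for x
      using DERIV_flat[of 0 x] by (simp add: numeral_2_eq_2)
    have d2: "((\<lambda>x. flat 0 (b - x)) has_real_derivative - flat 2 (b - x)) (at x)"
    proof -
      have "((\<lambda>x. b - x) has_real_derivative - 1) (at x)"
        by (auto intro!: derivative_eq_intros)
      from DERIV_chain2[OF d1 this] show ?thesis by simp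
    qed
    have "(d has_real_derivative flat 2 x + - flat 2 (b - x)) (at x)"
      unfolding d_def by (intro DERIV_add d1 d2)
    from DERIV_divide[OF d1 this] pos[of x] show ?thesis
      unfolding \<psi>_def \<psi>'_def
      by (auto elim!: DERIV_cong simp: d_def power2_eq_square algebra_simps)
  qed
  have "\<psi>' x \<ge> 0" for x
    unfolding \<psi>'_def by (intro divide_nonneg_nonneg add_nonneg_nonneg mult_nonneg_nonneg flat_nonneg) auto
  then show "mono \<psi>"
    using D by (meson DERIV_nonneg_imp_nondecreasing monoI)
  show "\<psi> x = 0" if "x \<le> 0" for x
    using that by (simp add: \<psi>_def flat_eq_0)
  show "\<psi> x = 1" if "b \<le> x" for x
    using that pos[of x] by (simp add: \<psi>_def d_def flat_eq_0)
  show "deriv \<psi> x > 0" if "0 < x" "x < b" for x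
  proof -
    have "\<psi>' x > 0"
      unfolding \<psi>'_def using that pos[of x]
      by (intro divide_pos_pos add_pos_pos mult_pos_pos flat_pos) auto
    then show ?thesis using DERIV_imp_deriv[OF D] by simp
  qed
qed

section \<open>Diffeomorphisms\<close>

text \<open>A positive derivative gives injectivity, and a continuous injection of the line is a
  homeomorphism onto its image.\<close>

lemma diffeomorphismI:
  assumes "smooth f" "\<And>x. deriv f x > 0" "surj f"
  shows "diffeomorphism f"
proof -
  have "strict_mono f"
  proof (rule strict_monoI)
    fix x y :: real assume "x < y"
    then show "f x < f y"
      by (rule DERIV_pos_imp_increasing) (use assms(1,2) smooth_has_deriv in blast)
  qed
  then have "inj f" by (simp add: strict_mono_imp_inj_on)
  then have "\<exists>g. homeomorphism UNIV (f ` UNIV) f g"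
    using injective_into_1d_eq_homeomorphism[OF smooth_continuous[OF assms(1)] path_connected_UNIV]
    by blast
  moreover have "deriv f x \<noteq> 0" for x
    using assms(2)[of x] by simp
  ultimately show ?thesis
    using assms by (auto simp: diffeomorphism_def)
qed

lemma diffeomorphism_inverseE:
  assumes "diffeomorphism f"
  obtains g where "diffeomorphism g" "\<And>x. f (g x) = x" "\<And>x. g (f x) = x"
proof -
  obtain g where g: "homeomorphism UNIV UNIV f g"
    using assms by (auto simp: diffeomorphism_def)
  then show thesis
    using that[OF diffeomorphism_inverse[OF assms g]] by (auto simp: homeomorphism_def)
qed

lemma deriv_mult_deriv_inverse:
  assumes "smooth f" "smooth g" "\<And>x. f (g x) = x"
  shows "deriv f (g x) * deriv g x = 1"
proof -
  have "((\<lambda>x. f (g x)) has_real_derivative deriv f (g x) * deriv g x) (at x)"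
    using assms by (intro DERIV_chain2 smooth_has_deriv)
  then show ?thesis
    using assms(3) DERIV_unique[OF _ DERIV_ident] by auto
qed

text \<open>The derivative is continuous, so its range is connected, and it omits 0.\<close>

lemma diffeomorphism_deriv_sign:
  assumes "diffeomorphism f"
  shows "(\<forall>x. deriv f x > 0) \<or> (\<forall>x. deriv f x < 0)"
proof (rule ccontr)
  assume "\<not> ?thesis"
  then obtain x y where xy: "deriv f x \<le> 0" "0 \<le> deriv f y" by (auto simp: not_less)
  have "connected (range (deriv f))"
    using assms smooth_continuous[OF smooth_deriv] connected_continuous_image
    by (auto simp: diffeomorphism_def)
  from connectedD_interval[OF this _ _ xy] have "0 \<in> range (deriv f)" by auto
  then show False using assms by (auto simp: diffeomorphism_def)
qed

text \<open>Such a map is its own inverse, which yields the homeomorphism; the chain rule applied to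
  \<tau>(\<tau> x) = x shows that its derivative never vanishes.\<close>

lemma involution_Diffeo_iff:
  "involution Diffeo \<tau> \<longleftrightarrow> smooth \<tau> \<and> (\<forall>x. \<tau> (\<tau> x) = x)"
proof
  assume "involution Diffeo \<tau>"
  then show "smooth \<tau> \<and> (\<forall>x. \<tau> (\<tau> x) = x)"
    by (auto simp: involution_def Diffeo_def diffeomorphism_def numeral_2_eq_2 fun_eq_iff
        nat_pow_def)
next
  assume \<tau>: "smooth \<tau> \<and> (\<forall>x. \<tau> (\<tau> x) = x)"
  have "homeomorphism UNIV UNIV \<tau> \<tau>"
    using \<tau> smooth_continuous surjI[of \<tau> \<tau>] by (auto simp: homeomorphism_def)
  moreover have "deriv \<tau> x \<noteq> 0" for x
    using deriv_mult_deriv_inverse[of \<tau> \<tau> x] \<tau> by auto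
  ultimately show "involution Diffeo \<tau>"
    using \<tau> by (auto simp: involution_def Diffeo_def diffeomorphism_def numeral_2_eq_2 fun_eq_iff
        nat_pow_def)
qed

section \<open>Diffeomorphisms without fixed points\<close>

text \<open>A bounded orbit would increase to a limit, which by continuity would be a fixed point of
  \<open>g\<close>.\<close>

lemma funpow_unbounded:
  fixes g :: "real \<Rightarrow> real"
  assumes "continuous_on UNIV g" "\<And>x. x < g x"
  shows "\<exists>n. c \<le> (g ^^ n) x"
proof (rule ccontr)
  assume "\<not> ?thesis"
  then have bd: "(g ^^ n) x \<le> c" for n by (simp add: less_imp_le not_le)
  have "incseq (\<lambda>n. (g ^^ n) x)"
    using assms(2) by (auto intro!: incseq_SucI less_imp_le)
  then obtain L where L: "(\<lambda>n. (g ^^ n) x) \<longlonglongrightarrow> L"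
    using incseq_convergent bd by metis
  have "isCont g L" using assms(1) by (simp add: continuous_on_eq_continuous_at)
  then have "(\<lambda>n. g ((g ^^ n) x)) \<longlonglongrightarrow> g L"
    using L by (rule isCont_tendsto_compose)
  moreover have "(\<lambda>n. g ((g ^^ n) x)) \<longlonglongrightarrow> L"
    using LIMSEQ_Suc[OF L] by simp
  ultimately show False
    using LIMSEQ_unique assms(2)[of L] by fastforce
qed

lemma funpow_left_inverse:
  fixes g h :: "'a \<Rightarrow> 'a"
  assumes "\<And>x. h (g x) = x"
  shows "(h ^^ n) ((g ^^ n) x) = x"
  by (induction n) (simp_all add: assms funpow_swap1[of h])

text \<open>The interval (a, g a] meets every orbit: iterating \<open>g\<close> carries any point
  beyond \<open>a\<close>, and pulling back by \<open>g\<close> then brings it into the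
  interval.\<close>

lemma fundamental_domain_induct:
  fixes g :: "real \<Rightarrow> real"
  assumes "continuous_on UNIV g" "strict_mono g" "surj g" "\<And>x. x < g x"
    and base: "\<And>x. a < x \<Longrightarrow> x \<le> g a \<Longrightarrow> P x"
    and step: "\<And>x. P (g x) \<longleftrightarrow> P x"
  shows "P x"
proof -
  have right: "P x" if "a < x" "x \<le> (g ^^ n) a" for n x
    using that
  proof (induction n arbitrary: x)
    case (Suc n)
    show ?case
    proof (cases "x \<le> g a")
      case False
      obtain y where y: "x = g y" using assms(3) by blast
      then have "a < y" "y \<le> (g ^^ n) a"
        using False Suc.prems assms(2) by (auto simp: strict_mono_less strict_mono_less_eq not_le)
      then show ?thesis using Suc.IH step y by blast
    qed (use Suc.prems base in blast)
  qed simp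
  have iter: "P ((g ^^ n) x) \<longleftrightarrow> P x" for n
    by (induction n) (simp_all add: step)
  \<comment> \<open>Aiming at \<open>g a\<close> instead of \<open>a\<close> makes the inequality
    with \<open>a\<close> strict.\<close>
  obtain n where "g a \<le> (g ^^ n) x"
    using funpow_unbounded assms(1,4) by blast
  then have "a < (g ^^ n) x" using assms(4)[of a] by linarith
  moreover obtain m where "(g ^^ n) x \<le> (g ^^ m) a"
    using funpow_unbounded assms(1,4) by blast
  ultimately show ?thesis using right iter by blast
qed

text \<open>A decreasing \<open>g\<close> would send 0 < g 0 to g (g 0) < g 0, against the
  hypothesis at \<open>g 0\<close>.\<close>

lemma diffeomorphism_above_id_deriv_pos:
  assumes "diffeomorphism g" "\<And>x. x < g x"
  shows "deriv g x > 0"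
proof (rule ccontr)
  assume "\<not> ?thesis"
  then have neg: "deriv g y < 0" for y
    using diffeomorphism_deriv_sign[OF assms(1)] by blast
  have "smooth g" using assms(1) by (simp add: diffeomorphism_def)
  then have "g (g 0) < g 0"
    using DERIV_neg_imp_decreasing[OF assms(2)[of 0], of g] neg smooth_has_deriv by blast
  then show False using assms(2)[of "g 0"] by simp
qed

text \<open>With \<open>\<psi>\<close> a smooth step rising from 0 to 1 on an interval containing a fundamental domain of
  \<open>g\<close>, the Abel function is formally the sum over all integers \<open>n\<close> of \<open>\<psi> \<circ> g\<^sup>n\<close>, normalised by
  subtracting 1 when \<open>n \<ge> 0\<close>. The terms \<open>n\<close> and \<open>- n - 1\<close> are grouped, and only finitely many groups
  are nonzero on a bounded set.\<close>

lemma abel_function: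
  assumes g: "diffeomorphism g" and above: "\<And>x. x < g x"
  obtains \<phi> where "diffeomorphism \<phi>" "\<And>x. \<phi> (g x) = \<phi> x + 1"
proof -
  have smg: "smooth g" using g by (simp add: diffeomorphism_def)
  have mono_g: "strict_mono g"
    using diffeomorphism_above_id_deriv_pos[OF g above] smooth_has_deriv[OF smg]
    by (meson DERIV_pos_imp_increasing strict_monoI)
  obtain h where h: "diffeomorphism h" and gh: "\<And>x. g (h x) = x" and hg: "\<And>x. h (g x) = x"
    using diffeomorphism_inverseE[OF g] by blast
  have smh: "smooth h" using h by (simp add: diffeomorphism_def)
  have mono_h: "strict_mono h"
    by (rule strict_monoI) (metis gh mono_g strict_mono_less)
  have mono_gn: "mono (g ^^ n)" and mono_hn: "mono (h ^^ n)" for n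
    using mono_g mono_h by (auto intro: mono_pow strict_mono_mono)
  have hngn: "(h ^^ n) ((g ^^ n) x) = x" for n x
    using hg by (rule funpow_left_inverse)
  have cont_g: "continuous_on UNIV g" using smg by (rule smooth_continuous)
  have surj_g: "surj g" using gh by (metis surjI)

  \<comment> \<open>The derivative of the step is positive only on the open interval (0, b), which
    has to contain (0, g 0].\<close>
  define b where "b = g 0 + 1"
  have b: "0 < b" "g 0 < b" using above[of 0] by (auto simp: b_def)
  obtain \<psi> where sm\<psi>: "smooth \<psi>" and mono\<psi>: "mono \<psi>" and \<psi>0: "\<And>x. x \<le> 0 \<Longrightarrow> \<psi> x = 0"
    and \<psi>1: "\<And>x. b \<le> x \<Longrightarrow> \<psi> x = 1" and \<psi>': "\<And>x. 0 < x \<Longrightarrow> x < b \<Longrightarrow> deriv \<psi> x > 0"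
    using smooth_step[OF b(1)] by blast

  define t where "t n x = \<psi> ((g ^^ n) x) - 1 + \<psi> ((h ^^ Suc n) x)" for n x
  define \<phi> where "\<phi> x = (\<Sum>n. t n x)" for x
  have sm_t: "smooth (t n)" for n
    unfolding t_def
    by (intro smooth_add smooth_diff smooth_const smooth_compose[OF sm\<psi>] smooth_funpow smg smh)
  have mono_t: "t n x \<le> t n y" if "x \<le> y" for n x y
    unfolding t_def using that by (intro add_mono diff_mono monoD[OF mono\<psi>] monoD[OF mono_gn]
        monoD[OF mono_hn] order_refl)
  \<comment> \<open>By monotonicity it suffices to move the endpoint \<open>- R\<close> above
    \<open>b\<close>, and to have \<open>R\<close> below the \<open>n\<close>-th image of 0 so that
    \<open>h ^^ n\<close> takes it below 0.\<close>
  have vanish: "\<exists>N. \<forall>n\<ge>N. \<forall>x. \<bar>x\<bar> \<le> R \<longrightarrow> \<psi> ((g ^^ n) x) = 1 \<and> \<psi> ((h ^^ n) x) = 0" for R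
  proof -
    have gmon: "(g ^^ m) x \<le> (g ^^ n) x" if "m \<le> n" for m n x
      by (rule lift_Suc_mono_le[OF _ that]) (simp add: above less_imp_le)
    obtain N1 where N1: "b \<le> (g ^^ N1) (- R)" using funpow_unbounded cont_g above by blast
    obtain N2 where N2: "R \<le> (g ^^ N2) 0" using funpow_unbounded cont_g above by blast
    show ?thesis
    proof (intro exI allI impI conjI)
      fix n x assume n: "max N1 N2 \<le> n" and x: "\<bar>x\<bar> \<le> R"
      have "b \<le> (g ^^ n) (- R)" using N1 gmon[of N1 n "- R"] n by simp
      also have "\<dots> \<le> (g ^^ n) x" using x by (intro monoD[OF mono_gn]) auto
      finally show "\<psi> ((g ^^ n) x) = 1" by (rule \<psi>1)
      have "x \<le> (g ^^ n) 0" using N2 gmon[of N2 n 0] n x by simp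
      from monoD[OF mono_hn this, of n] show "\<psi> ((h ^^ n) x) = 0"
        by (simp add: hngn \<psi>0)
    qed
  qed
  \<comment> \<open>Every cutoff from \<open>N\<close> on is allowed, so that cutoffs for different
    purposes can be matched.\<close>
  have fin: "\<exists>N. \<forall>n\<ge>N. \<forall>x. \<bar>x\<bar> \<le> R \<longrightarrow> \<phi> x = (\<Sum>k<n. t k x)" for R
  proof -
    obtain N where N: "\<And>n x. n \<ge> N \<Longrightarrow> \<bar>x\<bar> \<le> R \<Longrightarrow> \<psi> ((g ^^ n) x) = 1 \<and> \<psi> ((h ^^ n) x) = 0"
      using vanish[of R] by blast
    have "\<phi> x = (\<Sum>k<n. t k x)" if "n \<ge> N" "\<bar>x\<bar> \<le> R" for n x
      unfolding \<phi>_def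
    proof (rule suminf_finite)
      fix k assume "k \<notin> {..<n}"
      then have "N \<le> k" "N \<le> Suc k" using that(1) by auto
      then show "t k x = 0" using N[of k x] N[of "Suc k" x] that(2) by (simp add: t_def)
    qed simp
    then show ?thesis by blast
  qed

  have smooth_\<phi>: "smooth \<phi>"
  proof (rule smooth_local)
    fix x
    obtain N where N: "\<And>y. \<bar>y\<bar> \<le> \<bar>x\<bar> + 1 \<Longrightarrow> \<phi> y = (\<Sum>k<N. t k y)"
      using fin[of "\<bar>x\<bar> + 1"] by blast
    have "\<forall>\<^sub>F y in nhds x. y \<in> ball x 1"
      by (intro eventually_nhds_in_open) auto
    then have "\<forall>\<^sub>F y in nhds x. \<phi> y = (\<Sum>k<N. t k y)"
      by eventually_elim (rule N, auto simp: dist_real_def)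
    then show "\<exists>F. smooth F \<and> (\<forall>\<^sub>F y in nhds x. \<phi> y = F y)"
      using smooth_sum[of "{..<N}" t] sm_t by blast
  qed

  have abel: "\<phi> (g x) = \<phi> x + 1" for x
  proof -
    define R where "R = max \<bar>x\<bar> \<bar>g x\<bar>"
    obtain N1 where N1: "\<forall>n\<ge>N1. \<forall>x. \<bar>x\<bar> \<le> R \<longrightarrow> \<phi> x = (\<Sum>k<n. t k x)" using fin by blast
    obtain N2 where N2: "\<forall>n\<ge>N2. \<forall>x. \<bar>x\<bar> \<le> R \<longrightarrow> \<psi> ((g ^^ n) x) = 1 \<and> \<psi> ((h ^^ n) x) = 0"
      using vanish by blast
    define n where "n = max N1 N2"
    have le: "N1 \<le> n" "N2 \<le> n" "\<bar>x\<bar> \<le> R" "\<bar>g x\<bar> \<le> R" by (auto simp: n_def R_def)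
    have "\<phi> (g x) - \<phi> x = (\<Sum>k<n. t k (g x) - t k x)"
      using N1 le by (simp add: sum_subtractf)
    \<comment> \<open>Since \<open>h\<close> undoes \<open>g\<close>, each difference is the
      increment from \<open>k\<close> to \<open>Suc k\<close> of one sequence, which starts at 0 and
      is 1 at \<open>n\<close>.\<close>
    also have "\<dots> = (\<Sum>k<n. (\<psi> ((g ^^ Suc k) x) - \<psi> ((h ^^ Suc k) x))
        - (\<psi> ((g ^^ k) x) - \<psi> ((h ^^ k) x)))"
      by (intro sum.cong) (simp_all add: t_def funpow_swap1 hg)
    also have "\<dots> = (\<psi> ((g ^^ n) x) - \<psi> ((h ^^ n) x)) - (\<psi> ((g ^^ 0) x) - \<psi> ((h ^^ 0) x))"
      by (rule sum_lessThan_telescope)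
    also have "\<dots> = 1"
      using N2 le by simp
    finally show ?thesis by simp
  qed

  \<comment> \<open>All summands are nondecreasing, so keeping only index 0 bounds the growth of
    \<phi> from below by that of \<psi>. The cutoff \<open>Suc N\<close> guarantees that index 0
    occurs.\<close>
  have incr: "\<psi> y - \<psi> x \<le> \<phi> y - \<phi> x" if "x \<le> y" for x y
  proof -
    obtain N where N: "\<forall>n\<ge>N. \<forall>z. \<bar>z\<bar> \<le> max \<bar>x\<bar> \<bar>y\<bar> \<longrightarrow> \<phi> z = (\<Sum>k<n. t k z)" using fin by blast
    have "\<psi> y - \<psi> x \<le> t 0 y - t 0 x"
      using monoD[OF mono\<psi> monoD[OF mono_hn[of 1] that]] by (simp add: t_def)
    also have "\<dots> \<le> (\<Sum>k<Suc N. t k y - t k x)"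
      by (rule member_le_sum) (use mono_t[OF that] in auto)
    also have "\<dots> = \<phi> y - \<phi> x"
      using N[rule_format, of "Suc N" x] N[rule_format, of "Suc N" y] by (simp add: sum_subtractf)
    finally show ?thesis .
  qed
  have deriv_ge: "deriv \<psi> x \<le> deriv \<phi> x" for x
  proof -
    have "((\<lambda>x. \<phi> x - \<psi> x) has_real_derivative deriv \<phi> x - deriv \<psi> x) (at x)"
      by (intro DERIV_diff smooth_has_deriv smooth_\<phi> sm\<psi>)
    then have "deriv \<phi> x - deriv \<psi> x \<ge> 0"
    proof (rule mono_on_imp_deriv_nonneg[rotated])
      show "mono_on UNIV (\<lambda>x. \<phi> x - \<psi> x)"
        using incr by (intro mono_onI) (simp add: algebra_simps)
    qed simp
    then show ?thesis by simp
  qed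
  \<comment> \<open>Differentiating Abel's equation makes positivity of \<open>deriv \<phi>\<close>
    invariant under \<open>g\<close>; it then spreads from (0, g 0] to the whole line.\<close>
  have deriv_abel: "deriv \<phi> (g x) * deriv g x = deriv \<phi> x" for x
  proof -
    have "((\<lambda>x. \<phi> (g x)) has_real_derivative deriv \<phi> (g x) * deriv g x) (at x)"
      by (intro DERIV_chain2 smooth_has_deriv smooth_\<phi> smg)
    moreover have "((\<lambda>x. \<phi> (g x)) has_real_derivative deriv \<phi> x) (at x)"
      unfolding abel using DERIV_add[OF smooth_has_deriv[OF smooth_\<phi>] DERIV_const] by simp
    ultimately show ?thesis by (rule DERIV_unique)
  qed
  have "deriv \<phi> x > 0" for x
  proof (rule fundamental_domain_induct[OF cont_g mono_g surj_g above, of 0 "\<lambda>x. deriv \<phi> x > 0"])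
    show "deriv \<phi> x > 0" if "0 < x" "x \<le> g 0" for x
      using that b(2) \<psi>'[of x] deriv_ge[of x] by simp
    show "deriv \<phi> (g x) > 0 \<longleftrightarrow> deriv \<phi> x > 0" for x
      using diffeomorphism_above_id_deriv_pos[OF g above, of x] deriv_abel[of x]
      by (metis zero_less_mult_pos2 mult_pos_pos)
  qed
  moreover have "surj \<phi>"
  proof -
    have up: "\<phi> ((g ^^ n) x) = \<phi> x + of_nat n" for n x
      by (induction n) (simp_all add: abel)
    have "\<exists>x. \<phi> x = y" for y
    proof -
      \<comment> \<open>Along orbits \<phi> shifts by integers, so this \<open>n\<close> places
        \<open>y\<close> between \<phi> 0 - n and \<phi> 0 + n.\<close>
      obtain n where n: "\<bar>y\<bar> + \<bar>\<phi> 0\<bar> \<le> of_nat n" using real_arch_simple by blast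
      have gnhn: "(g ^^ n) ((h ^^ n) 0) = 0"
        using gh by (rule funpow_left_inverse)
      have "\<phi> ((h ^^ n) 0) \<le> y" using up[of n "(h ^^ n) 0"] gnhn n by simp
      moreover have "y \<le> \<phi> ((g ^^ n) 0)" using up[of n 0] n by simp
      moreover have "(h ^^ n) 0 \<le> (g ^^ n) 0"
      proof -
        have 1: "z \<le> (g ^^ n) z" for z
          by (rule lift_Suc_mono_le[of "\<lambda>n. (g ^^ n) z" 0 n, simplified]) (simp add: above less_imp_le)
        show ?thesis using 1[of "(h ^^ n) 0"] 1[of 0] gnhn by simp
      qed
      ultimately show ?thesis
        using IVT'[of \<phi> "(h ^^ n) 0" y "(g ^^ n) 0"] smooth_continuous[OF smooth_\<phi>]
          continuous_on_subset by blast
    qed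
    then show ?thesis by (metis surjI)
  qed
  ultimately have "diffeomorphism \<phi>" using diffeomorphismI[OF smooth_\<phi>] by blast
  then show thesis using that abel by blast
qed

section \<open>Products of involutions\<close>

text \<open>This is the reflection t -> c - t read in the coordinate \<open>k\<close>, with
  \<open>l\<close> the inverse of \<open>k\<close>.\<close>

lemma involution_conjugate:
  assumes "diffeomorphism k" "diffeomorphism l" "\<And>x. k (l x) = x" "\<And>x. l (k x) = x"
  shows "involution Diffeo (\<lambda>x. l (c - k x))"
  using assms unfolding involution_Diffeo_iff diffeomorphism_def
  by (auto intro!: smooth_compose[of l] smooth_diff smooth_const)

lemma above_id_product_of_two_involutions:
  assumes "diffeomorphism g" "\<And>x. x < g x"
  obtains \<sigma> \<tau> where "involution Diffeo \<sigma>" "involution Diffeo \<tau>" "g = \<sigma> \<circ> \<tau>"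
proof -
  obtain \<phi> where \<phi>: "diffeomorphism \<phi>" "\<And>x. \<phi> (g x) = \<phi> x + 1"
    using abel_function assms by blast
  obtain l where l: "diffeomorphism l" "\<And>x. \<phi> (l x) = x" "\<And>x. l (\<phi> x) = x"
    using diffeomorphism_inverseE[OF \<phi>(1)] by blast
  \<comment> \<open>In the coordinate \<phi>, \<open>g\<close> is t + 1 = 1 - (0 - t). Writing
    \<open>0 -\<close> makes both factors instances of \<open>involution_conjugate\<close>.\<close>
  have "g x = l (1 - \<phi> (l (0 - \<phi> x)))" for x
    using l(2) l(3)[of "g x"] \<phi>(2)[of x] by (simp add: add.commute)
  then have "g = (\<lambda>x. l (1 - \<phi> x)) \<circ> (\<lambda>x. l (0 - \<phi> x))"
    by auto
  then show thesis
    using that involution_conjugate[OF \<phi>(1) l] by blast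
qed

lemma decreasing_dominating_involution:
  assumes f: "diffeomorphism f" "\<And>x. deriv f x < 0"
  obtains \<tau> where "involution Diffeo \<tau>" "\<And>x. x < \<tau> (f x)"
proof -
  obtain h where h: "diffeomorphism h" "\<And>x. f (h x) = x" "\<And>x. h (f x) = x"
    using diffeomorphism_inverseE[OF f(1)] by blast
  have sm: "smooth f" "smooth h" using f(1) h(1) by (auto simp: diffeomorphism_def)
  \<comment> \<open>Derivatives of mutually inverse maps multiply to 1, so they share their
    sign.\<close>
  have h': "deriv h x < 0" for x
    using deriv_mult_deriv_inverse[OF sm h(2), of x] f(2)[of "h x"]
    by (metis mult_nonpos_nonneg less_imp_le not_one_le_zero not_less)
  \<comment> \<open>The involution will be \<open>k\<^sup>-\<^sup>1(- k x)\<close>. It lies above the inverse \<open>h\<close> of \<open>f\<close> as soon as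
    \<open>k x + k (f x) < 0\<close>; the two exponentials in \<open>k\<close> contribute \<open>- exp x\<close> and \<open>- exp (f x)\<close> to that sum.\<close>
  define k where "k x = x - (exp (f x) + exp (h x))" for x
  define k' where "k' x = 1 - (exp (f x) * deriv f x + exp (h x) * deriv h x)" for x
  have smk: "smooth k"
    unfolding k_def
    by (intro smooth_diff smooth_add smooth_ident smooth_compose[OF smooth_exp] sm)
  have Dk: "(k has_real_derivative k' x) (at x)" for x
    unfolding k_def k'_def
    by (intro DERIV_diff DERIV_ident DERIV_add DERIV_fun_exp smooth_has_deriv sm)
  \<comment> \<open>Both \<open>exp (f x)\<close> and \<open>exp (h x)\<close> decrease, so
    subtracting them only adds to the slope 1 of the identity.\<close>
  have k'_ge: "k' x \<ge> 1" for x
    using mult_pos_neg[OF exp_gt_zero[of "f x"] f(2)[of x]]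
      mult_pos_neg[OF exp_gt_zero[of "h x"] h'[of x]] by (simp add: k'_def)
  \<comment> \<open>Expansion of distances gives surjectivity of \<open>k\<close> and lets strict
    inequalities be pulled back through \<open>k\<close>.\<close>
  have grow: "y - x \<le> k y - k x" if "x \<le> y" for x y
  proof -
    have "\<exists>D. ((\<lambda>x. k x - x) has_real_derivative D) (at z) \<and> 0 \<le> D" for z
      using DERIV_diff[OF Dk DERIV_ident] k'_ge[of z] by force
    then have "k x - x \<le> k y - y"
      using DERIV_nonneg_imp_nondecreasing[OF that] by blast
    then show ?thesis by simp
  qed
  have "surj k"
  proof -
    have "\<exists>x. k x = y" for y
    proof -
      define r where "r = \<bar>y\<bar> + \<bar>k 0\<bar>"
      have "k (- r) \<le> y" "y \<le> k r"
        using grow[of 0 r] grow[of "- r" 0] unfolding r_def by linarith+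
      moreover have "- r \<le> r" by (simp add: r_def)
      ultimately show ?thesis
        using IVT'[of k "- r" y r] smooth_continuous[OF smk] continuous_on_subset by blast
    qed
    then show ?thesis by (metis surjI)
  qed
  moreover have "deriv k x > 0" for x
    using DERIV_imp_deriv[OF Dk] k'_ge[of x] by simp
  ultimately have k: "diffeomorphism k" using diffeomorphismI[OF smk] by blast
  then obtain l where l: "diffeomorphism l" "\<And>x. k (l x) = x" "\<And>x. l (k x) = x"
    using diffeomorphism_inverseE by blast
  have mono_k: "x < y" if "k x < k y" for x y
    using that grow[of y x] by (cases "x < y") auto
  have "x < l (0 - k (f x))" for x
  proof (rule mono_k)
    have "k x + k (f x) = (x - exp x) + (f x - exp (f x)) - exp (h x) - exp (f (f x))"
      by (simp add: k_def h(3))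
    \<comment> \<open>Each bracket u - exp u is at most -1.\<close>
    also have "\<dots> < 0"
      using exp_ge_add_one_self[of x] exp_ge_add_one_self[of "f x"] exp_gt_zero[of "h x"]
        exp_gt_zero[of "f (f x)"] by linarith
    finally show "k x < k (l (0 - k (f x)))" by (simp add: l(2))
  qed
  then show thesis
    using that involution_conjugate[OF k l] by blast
qed

text \<open>Composing \<open>f\<close> with the dominating involution gives a map above the
  identity, hence two involutions; applying the same involution again recovers
  \<open>f\<close>.\<close>

lemma decreasing_product_of_three_involutions:
  assumes f: "diffeomorphism f" "\<And>x. deriv f x < 0"
  obtains \<tau>\<^sub>1 \<tau>\<^sub>2 \<tau>\<^sub>3 where "involution Diffeo \<tau>\<^sub>1" "involution Diffeo \<tau>\<^sub>2" "involution Diffeo \<tau>\<^sub>3"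
    "f = \<tau>\<^sub>1 \<circ> \<tau>\<^sub>2 \<circ> \<tau>\<^sub>3"
proof -
  obtain \<tau> where \<tau>: "involution Diffeo \<tau>" "\<And>x. x < \<tau> (f x)"
    using decreasing_dominating_involution assms by blast
  have "diffeomorphism \<tau>" using \<tau>(1) by (simp add: involution_def Diffeo_def)
  then have "diffeomorphism (\<tau> \<circ> f)" using f(1) diffeomorphism_comp by blast
  then obtain \<sigma> \<rho> where "involution Diffeo \<sigma>" "involution Diffeo \<rho>" "\<tau> \<circ> f = \<sigma> \<circ> \<rho>"
    using above_id_product_of_two_involutions[of "\<tau> \<circ> f"] \<tau>(2) by auto
  moreover have "f = \<tau> \<circ> (\<tau> \<circ> f)"
    using \<tau>(1) by (auto simp: involution_Diffeo_iff)
  ultimately show thesis using that \<tau>(1) by (metis comp_assoc)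
qed

theorem theorem1p4:
  fixes f :: "real \<Rightarrow> real"
  assumes "f \<in> carrier Diffeo"
  shows "\<exists>\<tau>\<^sub>1 \<tau>\<^sub>2 \<tau>\<^sub>3 \<tau>\<^sub>4.
    involution Diffeo \<tau>\<^sub>1 \<and> involution Diffeo \<tau>\<^sub>2 \<and>
    involution Diffeo \<tau>\<^sub>3 \<and> involution Diffeo \<tau>\<^sub>4 \<and>
    f = \<tau>\<^sub>1 \<otimes>\<^bsub>Diffeo\<^esub> \<tau>\<^sub>2 \<otimes>\<^bsub>Diffeo\<^esub> \<tau>\<^sub>3 \<otimes>\<^bsub>Diffeo\<^esub> \<tau>\<^sub>4"
proof -
  have f: "diffeomorphism f" using assms by (simp add: Diffeo_def)
  have mult: "a \<otimes>\<^bsub>Diffeo\<^esub> b = a \<circ> b" for a b by (simp add: Diffeo_def)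
  consider "\<forall>x. deriv f x < 0" | "\<forall>x. deriv f x > 0"
    using diffeomorphism_deriv_sign[OF f] by blast
  then show ?thesis
  proof cases
    case 1
    then obtain \<tau>\<^sub>1 \<tau>\<^sub>2 \<tau>\<^sub>3 where "involution Diffeo \<tau>\<^sub>1" "involution Diffeo \<tau>\<^sub>2" "involution Diffeo \<tau>\<^sub>3"
      "f = \<tau>\<^sub>1 \<circ> \<tau>\<^sub>2 \<circ> \<tau>\<^sub>3"
      using decreasing_product_of_three_involutions[OF f] by blast
    \<comment> \<open>The trivial involution fills the fourth place.\<close>
    moreover have "involution Diffeo (\<lambda>x. x)"
      by (simp add: involution_Diffeo_iff smooth_ident)
    moreover have "f = f \<circ> (\<lambda>x. x)" by auto
    ultimately show ?thesis unfolding mult by metis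
  next
    case 2
    \<comment> \<open>Precomposing with this reflection reverses orientation; being its own inverse,
      it also serves as the fourth factor.\<close>
    define \<nu> :: "real \<Rightarrow> real" where "\<nu> x = - x" for x
    have \<nu>: "involution Diffeo \<nu>"
      unfolding \<nu>_def by (simp add: involution_Diffeo_iff smooth_uminus smooth_ident)
    then have "diffeomorphism (f \<circ> \<nu>)"
      using diffeomorphism_comp[OF f] by (simp add: involution_def Diffeo_def)
    moreover have "deriv (f \<circ> \<nu>) x < 0" for x
    proof -
      have "(f has_real_derivative deriv f (- x)) (at (- x))"
        using f by (intro smooth_has_deriv) (simp add: diffeomorphism_def)
      then have "(f \<circ> \<nu> has_real_derivative - deriv f (- x)) (at x)"
        using DERIV_mirror[of f "deriv f (- x)" x] by (simp add: comp_def \<nu>_def)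
      then show ?thesis using DERIV_imp_deriv 2 by fastforce
    qed
    ultimately obtain \<tau>\<^sub>1 \<tau>\<^sub>2 \<tau>\<^sub>3 where "involution Diffeo \<tau>\<^sub>1" "involution Diffeo \<tau>\<^sub>2"
      "involution Diffeo \<tau>\<^sub>3" "f \<circ> \<nu> = \<tau>\<^sub>1 \<circ> \<tau>\<^sub>2 \<circ> \<tau>\<^sub>3"
      using decreasing_product_of_three_involutions by blast
    moreover have "f = f \<circ> \<nu> \<circ> \<nu>" by (auto simp: \<nu>_def)
    ultimately show ?thesis unfolding mult using \<nu> by metis
  qed
qed

end
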